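(* Let $\{S_n\}_{n\in\mathbb{Z}_+}$ be a semi-random walk on $\mathbb{R}^d$ with period $p\in\mathbb{N}$. Then the following hold. (i) If $\{S_n\}_{n\in\mathbb{Z}_+}$ is $0$-recurrent, then it is recurrent. (ii) $\{S_n\}_{n\in\mathbb{Z}_+}$ is either recurrent or transient. (iii) $\{S_n\}_{n\in\mathbb{Z}_+}$ is recurrent if and only if $\sum_{n=1}^\infty P(S_n\in B_a)=\infty$ for every $a>0$. (iv) $\{S_n\}_{n\in\mathbb{Z}_+}$ is transient if and only if $\sum_{n=1}^\infty P(S_n\in B_a)<\infty$ for every $a>0$. (v) $\{S_n\}_{n\in\mathbb{Z}_+}$ is recurrent if and only if the random walk $\{S_{np}\}_{n\in\mathbb{Z}_+}$ is recurrent.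
   Context: For $p\in\mathbb{N}=\{1,2,\dots\}$, a sequence of $\mathbb{R}^d$-valued random variables $\{S_n\}_{n\in\mathbb{Z}_+}$ is a semi-random walk with period $p$ if $S_0=0$ a.s., it has independent increments (for any $0\le n_0<n_1<\dots<n_k$ the random variables $S_{n_1}-S_{n_0},\dots,S_{n_k}-S_{n_{k-1}}$ are mutually independent), and $S_{n+p}-S_{m+p}$ and $S_n-S_m$ have the same distribution for all $n,m\in\mathbb{Z}_+$. If $\{S_n\}$ is a semi-random walk with period $p$, then $\{S_{np}\}_{n\in\mathbb{Z}_+}$ is a random walk (i.e. a semi-random walk with period $1$). For $m\in\mathbb{Z}_+$, a semi-random walk $\{S_n\}$ is $m$-recurrent if $\liminf_{n\to\infty}|S_n-S_m|=0$ a.s.; it is recurrent if it is $m$-recurrent for every $m\in\mathbb{Z}_+$; it is transient if $\lim_{n\to\infty}|S_n|=\infty$ a.s. The same terminology applies to random walks. Notation: $\mathbb{Z}_+$ is the set of nonnegative integers, $|x|$ is the Euclidean norm, and $B_a=\{x\in\mathbb{R}^d: |x|<a\}$. *)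

theory Defs
  imports "HOL-Probability.Probability"
begin

locale semi_random_walk = prob_space M
  for M :: "'a measure" +
  fixes S :: "nat \<Rightarrow> 'a \<Rightarrow> real ^ 'd" and p :: nat
  assumes period_pos: "1 \<le> p"
    and rv: "\<And>n. random_variable borel (S n)"
    and start: "AE \<omega> in M. S 0 \<omega> = 0"
    and indep_increments: "\<And>k t. strict_mono_on {..k} t \<Longrightarrow>
      indep_vars (\<lambda>_. borel) (\<lambda>i \<omega>. S (t (Suc i)) \<omega> - S (t i) \<omega>) {..<k}"
    and periodic_increments: "\<And>n m.
      distr M borel (\<lambda>\<omega>. S (n + p) \<omega> - S (m + p) \<omega>) = distr M borel (\<lambda>\<omega>. S n \<omega> - S m \<omega>)"

abbreviation random_walk :: "'a measure \<Rightarrow> (nat \<Rightarrow> 'a \<Rightarrow> real ^ 'd) \<Rightarrow> bool" where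
  "random_walk M S \<equiv> semi_random_walk M S 1"

(* The lower limit is taken in ereal, because a real-valued one need not exist. *)
definition m_recurrent :: "'a measure \<Rightarrow> nat \<Rightarrow> (nat \<Rightarrow> 'a \<Rightarrow> real ^ 'd) \<Rightarrow> bool" where
  "m_recurrent M m S \<longleftrightarrow>
    (AE \<omega> in M. liminf (\<lambda>n. ereal (norm (S n \<omega> - S m \<omega>))) = 0)"

definition recurrent :: "'a measure \<Rightarrow> (nat \<Rightarrow> 'a \<Rightarrow> real ^ 'd) \<Rightarrow> bool" where
  "recurrent M S \<longleftrightarrow> (\<forall>m. m_recurrent M m S)"

definition transient :: "'a measure \<Rightarrow> (nat \<Rightarrow> 'a \<Rightarrow> real ^ 'd) \<Rightarrow> bool" where
  "transient M S \<longleftrightarrow> (AE \<omega> in M. filterlim (\<lambda>n. norm (S n \<omega>)) at_top sequentially)"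

lemma (in semi_random_walk) random_walk_multiples: "random_walk M (\<lambda>n. S (n * p))"
proof
  show "(1::nat) \<le> 1" by simp
  show "random_variable borel (S (n * p))" for n by (rule rv)
  show "AE \<omega> in M. S (0 * p) \<omega> = 0" using start by simp
  show "indep_vars (\<lambda>_. borel) (\<lambda>i \<omega>. S (t (Suc i) * p) \<omega> - S (t i * p) \<omega>) {..<k}"
    if "strict_mono_on {..k} t" for k and t :: "nat \<Rightarrow> nat"
  proof -
    have "strict_mono_on {..k} (\<lambda>i. t i * p)"
      using that period_pos by (auto simp: strict_mono_on_def)
    from indep_increments[OF this] show ?thesis .
  qed
  show "distr M borel (\<lambda>\<omega>. S ((n + 1) * p) \<omega> - S ((m + 1) * p) \<omega>) =
      distr M borel (\<lambda>\<omega>. S (n * p) \<omega> - S (m * p) \<omega>)" for n m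
    using periodic_increments[of "n * p" "m * p"] by (simp add: add.commute)
qed

end

theory Submission
  imports Defs
begin

text \<open>
  Everything follows from one implication (\<open>recurrent_of_not_summable\<close>): if the expected number of
  visits to some ball around the origin is infinite, then the walk is recurrent. If no such ball
  exists, the first Borel--Cantelli lemma gives transience. A \<open>0\<close>-recurrent walk visits every ball
  around the origin infinitely often, so Borel--Cantelli also shows that its expected number of
  visits is infinite. Since recurrence and transience exclude each other, this is the whole
  dichotomy with both series criteria; the comparison with the multiples of the period only
  needs the series over the multiples of \<open>p\<close> to be related to the full one.

  The proof of the implication has three ingredients.

  \<^item> Along one residue class \<open>q\<close> modulo \<open>p\<close> the series still diverges. Write \<open>T k = S (q + k * p)\<close>.
    The increments of \<open>T\<close> after time \<open>k\<close> are independent of \<open>T k\<close> and have the joint law of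
    those after time \<open>0\<close>. By compactness some ball \<open>B\<close> of radius \<open>e / 2\<close> has
    \<open>(\<Sum>k. P (T k \<in> B)) = \<infinity>\<close>. The events ``\<open>T\<close> is in \<open>B\<close> at time \<open>k\<close> and at distance
    at least \<open>e\<close> from \<open>T k\<close> from time \<open>k + m\<close> on'' have probability \<open>P (T k \<in> B) * \<rho>\<close>, where \<open>\<rho>\<close>
    does not depend on \<open>k\<close>, and no outcome lies in more than \<open>m\<close> of them. Hence \<open>\<rho> = 0\<close>, that is,
    \<open>T\<close> returns \<open>e\<close>-close to its starting point infinitely often
    (\<open>prob_no_return_eq_0\<close>, \<open>AE_frequently_return\<close>).

  \<^item> The law of \<open>S (m + k * p) - S m\<close> is that of \<open>S (k * p)\<close> as soon as \<open>m \<le> k * p\<close>: both are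
    convolutions of the same two laws, in opposite orders (\<open>distr_shifted_period\<close>). Divergence of
    the series of return probabilities therefore passes from one starting time to every other.

  \<^item> The walk restarted at time \<open>m\<close> is again a semi-random walk (\<open>shifted_walk\<close>), so the first
    ingredient applies to it and yields \<open>m\<close>-recurrence.
\<close>

section \<open>Real sequences and sets of natural numbers\<close>

text \<open>The radii are restricted to a sequence so that the almost sure quantifier can be
  interchanged with the quantifier over the radii.\<close>
lemma liminf_eq_0_iff_frequently_small:
  fixes f :: "nat \<Rightarrow> real"
  assumes "\<And>n. 0 \<le> f n"
  shows "liminf (\<lambda>n. ereal (f n)) = 0 \<longleftrightarrow>
    (\<forall>k. \<exists>\<^sub>F n in sequentially. f n < inverse (real (Suc k)))"
proof -
  have nonneg: "0 \<le> liminf (\<lambda>n. ereal (f n))"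
    using assms by (intro Liminf_bounded) (auto intro: always_eventually)
  have freq: "(\<exists>\<^sub>F n in sequentially. f n < e) \<longleftrightarrow> \<not> (\<forall>\<^sub>F n in sequentially. e \<le> f n)" for e
    by (simp add: frequently_def not_less)
  show ?thesis
  proof
    assume lim: "liminf (\<lambda>n. ereal (f n)) = 0"
    show "\<forall>k. \<exists>\<^sub>F n in sequentially. f n < inverse (real (Suc k))"
    proof (intro allI, unfold freq, rule notI)
      fix k assume "\<forall>\<^sub>F n in sequentially. inverse (real (Suc k)) \<le> f n"
      then have "ereal (inverse (real (Suc k))) \<le> liminf (\<lambda>n. ereal (f n))"
        by (intro Liminf_bounded) auto
      with lim show False by (simp add: zero_ereal_def)
    qed
  next
    assume small: "\<forall>k. \<exists>\<^sub>F n in sequentially. f n < inverse (real (Suc k))"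
    show "liminf (\<lambda>n. ereal (f n)) = 0"
    proof (rule ccontr)
      assume "liminf (\<lambda>n. ereal (f n)) \<noteq> 0"
      with nonneg have "0 < liminf (\<lambda>n. ereal (f n))" by simp
      then obtain e where e: "0 < ereal e" "ereal e < liminf (\<lambda>n. ereal (f n))"
        using ereal_dense2 by blast
      obtain k where k: "inverse (real (Suc k)) < e"
        using e(1) reals_Archimedean[of e] by auto
      have "\<forall>\<^sub>F n in sequentially. ereal e < ereal (f n)"
        using e(2) by (rule less_LiminfD)
      then have "\<forall>\<^sub>F n in sequentially. inverse (real (Suc k)) \<le> f n"
        by eventually_elim (use k in auto)
      with small show False by (auto simp: freq)
    qed
  qed
qed

lemma summable_residue_classes:
  fixes f :: "nat \<Rightarrow> real"
  assumes p: "1 \<le> p" and "\<And>q. q < p \<Longrightarrow> summable (\<lambda>k. f (q + k * p))"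
  shows "summable f"
proof -
  define g where "g q n = (if n mod p = q then f n else 0)" for q n
  have "summable (g q)" if q: "q < p" for q
  proof -
    have "summable (\<lambda>k. g q (q + k * p)) \<longleftrightarrow> summable (g q)"
    proof (rule summable_mono_reindex)
      show "strict_mono (\<lambda>k. q + k * p)" using p by (auto simp: strict_mono_def)
      fix n assume n: "n \<notin> range (\<lambda>k. q + k * p)"
      have "n mod p \<noteq> q"
      proof
        assume "n mod p = q"
        then have "n = q + (n div p) * p" using mod_div_mult_eq[of n p] by simp
        with n show False by blast
      qed
      then show "g q n = 0" by (simp add: g_def)
    qed
    moreover have "g q (q + k * p) = f (q + k * p)" for k using q by (simp add: g_def)
    ultimately show ?thesis using assms(2)[OF q] by simp
  qed
  then have "summable (\<lambda>n. \<Sum>q<p. g q n)" by (intro summable_sum) auto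
  moreover have "(\<Sum>q<p. g q n) = f n" for n
    using p by (simp add: g_def)
  ultimately show ?thesis by simp
qed

lemma card_le_of_bounded_gaps:
  fixes J :: "nat set"
  assumes "finite J" "0 < m" "\<And>x y. x \<in> J \<Longrightarrow> y \<in> J \<Longrightarrow> x < y \<Longrightarrow> y < x + m"
  shows "card J \<le> m"
proof (cases "J = {}")
  case False
  have "J \<subseteq> {Min J..<Min J + m}"
  proof
    fix y assume y: "y \<in> J"
    have "Min J \<in> J" "Min J \<le> y" using assms(1) False y by auto
    then show "y \<in> {Min J..<Min J + m}"
      using assms(2) assms(3)[of "Min J" y] y by (cases "Min J = y") auto
  qed
  then have "card J \<le> card {Min J..<Min J + m}" by (intro card_mono) auto
  then show ?thesis by simp
qed simp

section \<open>Borel--Cantelli and overlapping events\<close>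

context prob_space
begin

text \<open>The sum of the probabilities is the expected number of events that occur.\<close>
lemma sum_prob_le_overlap:
  assumes I: "finite I" and ev: "\<And>i. i \<in> I \<Longrightarrow> E i \<in> events"
    and overlap: "\<And>\<omega>. \<omega> \<in> space M \<Longrightarrow> card {i \<in> I. \<omega> \<in> E i} \<le> m"
  shows "(\<Sum>i\<in>I. prob (E i)) \<le> real m"
proof -
  have int: "integrable M (\<lambda>\<omega>. indicator (E i) \<omega> :: real)" if "i \<in> I" for i
    using ev[OF that] by (simp add: integrable_indicator_iff less_top[symmetric])
  have "(\<Sum>i\<in>I. prob (E i)) = (\<Sum>i\<in>I. expectation (indicator (E i)))"
    using ev by (intro sum.cong) (auto simp: Int_absorb2 sets.sets_into_space)
  also have "\<dots> = expectation (\<lambda>\<omega>. \<Sum>i\<in>I. indicator (E i) \<omega>)"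
    using int by (intro Bochner_Integration.integral_sum[symmetric]) auto
  also have "\<dots> \<le> expectation (\<lambda>_. real m)"
  proof (rule integral_mono)
    show "integrable M (\<lambda>\<omega>. \<Sum>i\<in>I. indicator (E i) \<omega> :: real)"
      using int by (intro Bochner_Integration.integrable_sum) auto
    fix \<omega> assume "\<omega> \<in> space M"
    have "(\<Sum>i\<in>I. indicator (E i) \<omega> :: real) = (\<Sum>i\<in>{i\<in>I. \<omega> \<in> E i}. 1)"
      using I by (intro sum.mono_neutral_cong_right) (auto simp: indicator_def)
    also have "\<dots> = real (card {i\<in>I. \<omega> \<in> E i})" by simp
    also have "\<dots> \<le> real m" using overlap[OF \<open>\<omega> \<in> space M\<close>] by simp
    finally show "(\<Sum>i\<in>I. indicator (E i) \<omega> :: real) \<le> real m" .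
  qed simp
  also have "\<dots> = real m" by (simp add: prob_space)
  finally show ?thesis .
qed

lemma AE_eventually_not_of_summable:
  assumes [measurable]: "\<And>n. {\<omega> \<in> space M. Q n \<omega>} \<in> events"
    and "summable (\<lambda>n. prob {\<omega> \<in> space M. Q n \<omega>})"
  shows "AE \<omega> in M. \<forall>\<^sub>F n in sequentially. \<not> Q n \<omega>"
proof -
  have "AE \<omega> in M. \<forall>\<^sub>F n in sequentially. \<omega> \<in> space M - {\<omega> \<in> space M. Q n \<omega>}"
    using assms by (intro borel_cantelli_AE1) (auto simp: less_top[symmetric])
  then show ?thesis
    by (rule AE_mp) (auto intro!: AE_I2 elim: eventually_mono)
qed

lemma not_summable_of_AE_frequently:
  assumes "\<And>n. {\<omega> \<in> space M. Q n \<omega>} \<in> events"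
    and "AE \<omega> in M. \<exists>\<^sub>F n in sequentially. Q n \<omega>"
  shows "\<not> summable (\<lambda>n. prob {\<omega> \<in> space M. Q n \<omega>})"
proof
  assume "summable (\<lambda>n. prob {\<omega> \<in> space M. Q n \<omega>})"
  with assms have "AE \<omega> in M. \<forall>\<^sub>F n in sequentially. \<not> Q n \<omega>"
    by (intro AE_eventually_not_of_summable)
  with assms(2) have "AE \<omega> in M. False"
    by eventually_elim (simp add: frequently_def)
  then show False by simp
qed

end

section \<open>Independence and stationarity along a residue class\<close>

context semi_random_walk
begin

declare rv [measurable]

lemma distr_increment_shift:
  "distr M borel (\<lambda>\<omega>. S (n + k * p) \<omega> - S (m + k * p) \<omega>) =
    distr M borel (\<lambda>\<omega>. S n \<omega> - S m \<omega>)"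
proof (induction k)
  case (Suc k)
  show ?case
    using periodic_increments[of "n + k * p" "m + k * p"] Suc by (simp add: ac_simps)
qed simp

lemma shifted_walk: "semi_random_walk M (\<lambda>n \<omega>. S (q + n) \<omega> - S q \<omega>) p"
proof
  show "1 \<le> p" by (rule period_pos)
  show "random_variable borel (\<lambda>\<omega>. S (q + n) \<omega> - S q \<omega>)" for n by measurable
  show "AE \<omega> in M. S (q + 0) \<omega> - S q \<omega> = 0" by simp
  show "indep_vars (\<lambda>_. borel) (\<lambda>i \<omega>. S (q + t (Suc i)) \<omega> - S q \<omega> - (S (q + t i) \<omega> - S q \<omega>)) {..<k}"
    if "strict_mono_on {..k} t" for k and t :: "nat \<Rightarrow> nat"
  proof -
    have "strict_mono_on {..k} (\<lambda>i. q + t i)" using that by (auto simp: strict_mono_on_def)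
    from indep_increments[OF this] show ?thesis by simp
  qed
  show "distr M borel (\<lambda>\<omega>. S (q + (n + p)) \<omega> - S q \<omega> - (S (q + (m + p)) \<omega> - S q \<omega>)) =
      distr M borel (\<lambda>\<omega>. S (q + n) \<omega> - S q \<omega> - (S (q + m) \<omega> - S q \<omega>))" for n m
    using periodic_increments[of "q + n" "q + m"] by (simp add: ac_simps)
qed

text \<open>Each single increment is stationary under shifts by the period; since the increments are
  independent, their joint law is the product of the individual laws and hence stationary as well.\<close>
lemma distr_future_increments:
  "distr M (Pi\<^sub>M {..<Suc N} (\<lambda>_. borel))
      (\<lambda>\<omega>. \<lambda>i\<in>{..<Suc N}. S (q + k * p + Suc i * p) \<omega> - S (q + k * p + i * p) \<omega>) =
    distr M (Pi\<^sub>M {..<Suc N} (\<lambda>_. borel))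
      (\<lambda>\<omega>. \<lambda>i\<in>{..<Suc N}. S (q + Suc i * p) \<omega> - S (q + i * p) \<omega>)"
proof -
  have law: "distr M (Pi\<^sub>M {..<Suc N} (\<lambda>_. borel))
      (\<lambda>\<omega>. \<lambda>i\<in>{..<Suc N}. S (n + Suc i * p) \<omega> - S (n + i * p) \<omega>) =
    Pi\<^sub>M {..<Suc N} (\<lambda>i. distr M borel (\<lambda>\<omega>. S (n + Suc i * p) \<omega> - S (n + i * p) \<omega>))" for n
  proof -
    have "strict_mono_on {..Suc N} (\<lambda>i. n + i * p)"
      using period_pos by (auto simp: strict_mono_on_def)
    from indep_increments[OF this] show ?thesis
      by (subst (asm) indep_vars_iff_distr_eq_PiM') auto
  qed
  have "distr M borel (\<lambda>\<omega>. S (q + k * p + Suc i * p) \<omega> - S (q + k * p + i * p) \<omega>) =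
      distr M borel (\<lambda>\<omega>. S (q + Suc i * p) \<omega> - S (q + i * p) \<omega>)" for i
    using distr_increment_shift[of "q + Suc i * p" k "q + i * p"] by (simp add: ac_simps)
  then show ?thesis by (simp only: law)
qed

text \<open>Independence of a pair is a statement about two variables with values in the same type, so the
  single vector \<open>S n - S 0\<close> appears as a family indexed by \<open>{0}\<close>.\<close>
lemma indep_present_future:
  assumes "0 < n"
  shows "indep_var (Pi\<^sub>M {0} (\<lambda>_. borel)) (\<lambda>\<omega>. \<lambda>i\<in>{0::nat}. S n \<omega> - S 0 \<omega>)
      (Pi\<^sub>M {..<N} (\<lambda>_. borel)) (\<lambda>\<omega>. \<lambda>i\<in>{..<N}. S (n + Suc i * p) \<omega> - S (n + i * p) \<omega>)"
proof -
  \<comment> \<open>One jump from \<open>0\<close> to \<open>n\<close>, then steps of length \<open>p\<close>; the jump is nontrivial because \<open>0 < n\<close>.\<close>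
  define t where "t i = (case i of 0 \<Rightarrow> 0 | Suc j \<Rightarrow> n + j * p)" for i
  define Y where "Y i \<omega> = S (t (Suc i)) \<omega> - S (t i) \<omega>" for i \<omega>
  have "strict_mono_on {..Suc N} t"
    using period_pos assms by (auto simp: strict_mono_on_def t_def split: nat.splits)
  from indep_increments[OF this] have ind: "indep_vars (\<lambda>_. borel) Y {..<Suc N}"
    by (simp add: Y_def[abs_def])
  have "indep_var (Pi\<^sub>M {0} (\<lambda>_. borel)) (\<lambda>\<omega>. \<lambda>i\<in>{0}. Y i \<omega>)
      (Pi\<^sub>M {1..N} (\<lambda>_. borel)) (\<lambda>\<omega>. \<lambda>i\<in>{1..N}. Y i \<omega>)"
    by (rule indep_var_restrict[OF ind]) auto
  then have "indep_var (Pi\<^sub>M {0} (\<lambda>_. borel)) ((\<lambda>d. d) \<circ> (\<lambda>\<omega>. \<lambda>i\<in>{0}. Y i \<omega>))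
      (Pi\<^sub>M {..<N} (\<lambda>_. borel)) ((\<lambda>d. \<lambda>i\<in>{..<N}. d (Suc i)) \<circ> (\<lambda>\<omega>. \<lambda>i\<in>{1..N}. Y i \<omega>))"
    by (rule indep_var_compose) (auto intro!: measurable_restrict measurable_component_singleton)
  moreover have "(\<lambda>d. d) \<circ> (\<lambda>\<omega>. \<lambda>i\<in>{0}. Y i \<omega>) = (\<lambda>\<omega>. \<lambda>i\<in>{0}. S n \<omega> - S 0 \<omega>)"
    by (auto simp: fun_eq_iff Y_def t_def restrict_def)
  moreover have "(\<lambda>d. \<lambda>i\<in>{..<N}. d (Suc i)) \<circ> (\<lambda>\<omega>. \<lambda>i\<in>{1..N}. Y i \<omega>) =
      (\<lambda>\<omega>. \<lambda>i\<in>{..<N}. S (n + Suc i * p) \<omega> - S (n + i * p) \<omega>)"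
    by (auto simp: fun_eq_iff Y_def t_def restrict_def)
  ultimately show ?thesis by (simp only:)
qed

text \<open>The Markov property needed below: the displacements after time \<open>q + k * p\<close> do not depend on the
  position at that time, and they are distributed as those after time \<open>q\<close>. The window \<open>{m..N}\<close> is
  finite, so that only finitely many increments are involved.\<close>
lemma prob_present_and_escape:
  assumes n: "0 < q + k * p" and A[measurable]: "A \<in> sets borel"
  shows "prob {\<omega> \<in> space M. S (q + k * p) \<omega> \<in> A \<and>
        (\<forall>j\<in>{m..N}. e \<le> norm (S (q + (k + j) * p) \<omega> - S (q + k * p) \<omega>))} =
    prob {\<omega> \<in> space M. S (q + k * p) \<omega> \<in> A} *
    prob {\<omega> \<in> space M. \<forall>j\<in>{m..N}. e \<le> norm (S (q + j * p) \<omega> - S q \<omega>)}"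
proof -
  define D where "D n = (\<lambda>\<omega>. \<lambda>i\<in>{..<Suc N}. S (n + Suc i * p) \<omega> - S (n + i * p) \<omega>)" for n
  let ?P = "Pi\<^sub>M {..<Suc N} (\<lambda>_. borel :: (real ^ 'd) measure)"
  have D[measurable]: "D n \<in> measurable M ?P" for n
    unfolding D_def by measurable
  define G where "G = {d \<in> space ?P. \<forall>j\<in>{m..N}. e \<le> norm (\<Sum>i<j. d i)}"
  have "{d \<in> space ?P. e \<le> norm (\<Sum>i<j. d i)} \<in> sets ?P" if "j \<in> {m..N}" for j
  proof -
    have [measurable]: "(\<lambda>d. \<Sum>i<j. d i) \<in> borel_measurable ?P"
      using that by (intro borel_measurable_sum measurable_component_singleton) auto
    show ?thesis by measurable
  qed
  then have G[measurable]: "G \<in> sets ?P"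
    unfolding G_def by (intro sets.sets_Collect_finite_All) auto
  have tele: "(\<Sum>i<j. D n \<omega> i) = S (n + j * p) \<omega> - S n \<omega>" if "j \<in> {m..N}" for n j \<omega>
  proof -
    have "(\<Sum>i<j. D n \<omega> i) = (\<Sum>i<j. S (n + Suc i * p) \<omega> - S (n + i * p) \<omega>)"
      using that by (intro sum.cong) (auto simp: D_def)
    also have "\<dots> = S (n + j * p) \<omega> - S n \<omega>"
      using sum_lessThan_telescope[of "\<lambda>i. S (n + i * p) \<omega>" j] by simp
    finally show ?thesis .
  qed
  have mem_G: "D n \<omega> \<in> G \<longleftrightarrow> (\<forall>j\<in>{m..N}. e \<le> norm (S (n + j * p) \<omega> - S n \<omega>))"
    if "\<omega> \<in> space M" for n \<omega>
    using measurable_space[OF D that] by (simp add: G_def tele)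
  let ?n = "q + k * p"
  \<comment> \<open>The independence of increments concerns \<open>S ?n - S 0\<close>, which agrees almost surely with \<open>S ?n\<close>.\<close>
  define X where "X = (\<lambda>\<omega>. \<lambda>i\<in>{0::nat}. S ?n \<omega> - S 0 \<omega>)"
  define A' where "A' = (\<lambda>d. d 0) -` A \<inter> space (Pi\<^sub>M {0::nat} (\<lambda>_. borel :: (real ^ 'd) measure))"
  have A': "A' \<in> sets (Pi\<^sub>M {0::nat} (\<lambda>_. borel))"
    unfolding A'_def by (rule measurable_sets[of _ _ borel], rule measurable_component_singleton) (simp_all add: A)
  have X_in_A': "X \<omega> \<in> A' \<longleftrightarrow> S ?n \<omega> - S 0 \<omega> \<in> A" for \<omega>
    by (auto simp: X_def A'_def space_PiM)
  have "prob {\<omega> \<in> space M. S ?n \<omega> \<in> A \<and>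
        (\<forall>j\<in>{m..N}. e \<le> norm (S (q + (k + j) * p) \<omega> - S ?n \<omega>))} =
      prob {\<omega> \<in> space M. S ?n \<omega> \<in> A \<and> D ?n \<omega> \<in> G}"
    by (intro arg_cong[where f = prob] Collect_cong) (auto simp: mem_G algebra_simps)
  also have "\<dots> = prob {\<omega> \<in> space M. S ?n \<omega> - S 0 \<omega> \<in> A \<and> D ?n \<omega> \<in> G}"
    by (rule finite_measure_eq_AE) (use start in auto)
  also have "\<dots> = prob ((\<lambda>\<omega>. (X \<omega>, D ?n \<omega>)) -` (A' \<times> G) \<inter> space M)"
    by (intro arg_cong[where f = prob]) (auto simp: X_in_A')
  also have "\<dots> = prob (X -` A' \<inter> space M) * prob (D ?n -` G \<inter> space M)"
    unfolding X_def D_def by (rule indep_varD[OF indep_present_future[OF n] A' G])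
  also have "prob (X -` A' \<inter> space M) = prob {\<omega> \<in> space M. S ?n \<omega> - S 0 \<omega> \<in> A}"
    by (intro arg_cong[where f = prob]) (auto simp: X_in_A')
  also have "\<dots> = prob {\<omega> \<in> space M. S ?n \<omega> \<in> A}"
    by (rule finite_measure_eq_AE) (use start in auto)
  also have "prob (D ?n -` G \<inter> space M) = prob (D q -` G \<inter> space M)"
    using distr_future_increments[of N q k, folded D_def]
    by (metis D G measure_distr)
  also have "D q -` G \<inter> space M =
      {\<omega> \<in> space M. \<forall>j\<in>{m..N}. e \<le> norm (S (q + j * p) \<omega> - S q \<omega>)}"
    by (auto simp: mem_G)
  finally show ?thesis .
qed

section \<open>Almost sure return along a residue class\<close>

text \<open>A bounded ball is covered by finitely many balls of radius \<open>e\<close>, and a finite sum of summable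
  sequences is summable.\<close>
lemma not_summable_visits_smaller_ball:
  assumes inf: "\<not> summable (\<lambda>k. prob {\<omega> \<in> space M. norm (S (h k) \<omega>) < c})" and "0 < e"
  obtains x where "\<not> summable (\<lambda>k. prob {\<omega> \<in> space M. S (h k) \<omega> \<in> ball x e})"
proof -
  have "\<exists>F. finite F \<and> cball (0 :: real ^ 'd) c \<subseteq> (\<Union>x\<in>F. ball x e)"
    using compactE_image[of "cball (0 :: real ^ 'd) c" UNIV "\<lambda>x. ball x e"] \<open>0 < e\<close>
    by (metis (mono_tags, lifting) UN_I UNIV_I centre_in_ball compact_cball open_ball subsetI)
  then obtain F where F: "finite F" "cball (0 :: real ^ 'd) c \<subseteq> (\<Union>x\<in>F. ball x e)" by auto
  have "\<exists>x. \<not> summable (\<lambda>k. prob {\<omega> \<in> space M. S (h k) \<omega> \<in> ball x e})"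
  proof (rule ccontr)
    assume "\<nexists>x. \<not> summable (\<lambda>k. prob {\<omega> \<in> space M. S (h k) \<omega> \<in> ball x e})"
    then have "summable (\<lambda>k. \<Sum>x\<in>F. prob {\<omega> \<in> space M. S (h k) \<omega> \<in> ball x e})"
      by (intro summable_sum) auto
    moreover have "norm (prob {\<omega> \<in> space M. norm (S (h k) \<omega>) < c}) \<le>
        (\<Sum>x\<in>F. prob {\<omega> \<in> space M. S (h k) \<omega> \<in> ball x e})" for k
    proof -
      have "prob {\<omega> \<in> space M. norm (S (h k) \<omega>) < c} \<le>
          prob (\<Union>x\<in>F. {\<omega> \<in> space M. S (h k) \<omega> \<in> ball x e})"
      proof (rule finite_measure_mono)
        show "{\<omega> \<in> space M. norm (S (h k) \<omega>) < c} \<subseteq> (\<Union>x\<in>F. {\<omega> \<in> space M. S (h k) \<omega> \<in> ball x e})"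
        proof
          fix \<omega> assume "\<omega> \<in> {\<omega> \<in> space M. norm (S (h k) \<omega>) < c}"
          moreover from this have "S (h k) \<omega> \<in> cball 0 c" by simp
          ultimately show "\<omega> \<in> (\<Union>x\<in>F. {\<omega> \<in> space M. S (h k) \<omega> \<in> ball x e})"
            using F(2) by blast
        qed
      qed (use F(1) in \<open>auto intro!: sets.finite_UN\<close>)
      also have "\<dots> \<le> (\<Sum>x\<in>F. prob {\<omega> \<in> space M. S (h k) \<omega> \<in> ball x e})"
        by (rule finite_measure_subadditive_finite) (use F(1) in auto)
      finally show ?thesis by simp
    qed
    ultimately have "summable (\<lambda>k. prob {\<omega> \<in> space M. norm (S (h k) \<omega>) < c})"
      by (rule summable_comparison_test')
    with inf show False by simp
  qed
  with that show thesis by blast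
qed

text \<open>The number \<open>\<rho>\<close> is the probability of never coming \<open>e\<close>-close to the starting point after \<open>m\<close>
  periods. Starting from each visit to a fixed ball of radius \<open>e / 2\<close> there is the same chance \<open>\<rho>\<close>
  that no visit occurs \<open>m\<close> or more periods later, and fewer than \<open>m\<close> periods
  separate any two visits with this property. The expected number of such visits is therefore at
  most \<open>m\<close>, whereas the expected number of all visits is infinite.\<close>
lemma prob_no_return_eq_0:
  assumes inf: "\<not> summable (\<lambda>k. prob {\<omega> \<in> space M. norm (S (q + k * p) \<omega>) < c})"
    and "0 < e" "0 < m"
  shows "prob {\<omega> \<in> space M. \<forall>j\<ge>m. e \<le> norm (S (q + j * p) \<omega> - S q \<omega>)} = 0"
proof -
  define \<rho> where "\<rho> = prob {\<omega> \<in> space M. \<forall>j\<ge>m. e \<le> norm (S (q + j * p) \<omega> - S q \<omega>)}"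
  obtain x where "\<not> summable (\<lambda>k. prob {\<omega> \<in> space M. S (q + k * p) \<omega> \<in> ball x (e / 2)})"
    using not_summable_visits_smaller_ball[OF inf, of "e / 2"] \<open>0 < e\<close> by auto
  \<comment> \<open>The index starts at one because for \<open>q = 0\<close> the increment from time \<open>0\<close> to time \<open>q\<close> is trivial.\<close>
  moreover define a where "a k = prob {\<omega> \<in> space M. S (q + Suc k * p) \<omega> \<in> ball x (e / 2)}" for k
  ultimately have a_inf: "\<not> summable a"
    using summable_Suc_iff[of "\<lambda>k. prob {\<omega> \<in> space M. S (q + k * p) \<omega> \<in> ball x (e / 2)}"]
    by (simp add: a_def[abs_def])
  have bound: "(\<Sum>k<K. a k * \<rho>) \<le> real m" for K
  proof -
    \<comment> \<open>The window of length \<open>K\<close> reaches past every other index below \<open>K\<close>, so escape during this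
      window suffices to separate the events that are summed.\<close>
    define E where "E k = {\<omega> \<in> space M. S (q + Suc k * p) \<omega> \<in> ball x (e / 2) \<and>
      (\<forall>j\<in>{m..K}. e \<le> norm (S (q + (Suc k + j) * p) \<omega> - S (q + Suc k * p) \<omega>))}" for k
    have ev: "E k \<in> events" for k
      unfolding E_def
      by (intro sets.sets_Collect_conj sets.sets_Collect_finite_All) (measurable, auto)
    have "a k * \<rho> \<le> prob (E k)" for k
    proof -
      have "\<rho> \<le> prob {\<omega> \<in> space M. \<forall>j\<in>{m..K}. e \<le> norm (S (q + j * p) \<omega> - S q \<omega>)}"
        unfolding \<rho>_def by (intro finite_measure_mono) auto
      then have "a k * \<rho> \<le> a k * prob {\<omega> \<in> space M. \<forall>j\<in>{m..K}. e \<le> norm (S (q + j * p) \<omega> - S q \<omega>)}"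
        by (intro mult_left_mono) (auto simp: a_def)
      also have "\<dots> = prob (E k)"
        unfolding a_def E_def using period_pos
        by (intro prob_present_and_escape[symmetric]) auto
      finally show ?thesis .
    qed
    then have "(\<Sum>k<K. a k * \<rho>) \<le> (\<Sum>k<K. prob (E k))" by (intro sum_mono)
    also have "\<dots> \<le> real m"
    proof (rule sum_prob_le_overlap)
      fix \<omega>
      show "card {k \<in> {..<K}. \<omega> \<in> E k} \<le> m"
      proof (rule card_le_of_bounded_gaps)
        fix k l assume kl: "k \<in> {k \<in> {..<K}. \<omega> \<in> E k}" "l \<in> {k \<in> {..<K}. \<omega> \<in> E k}" "k < l"
        show "l < k + m"
        proof (rule ccontr)
          assume "\<not> l < k + m"
          then have gap: "l - k \<in> {m..K}" "Suc k + (l - k) = Suc l" using kl by auto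
          have "\<omega> \<in> E k" "\<omega> \<in> E l" using kl by auto
          then have "\<forall>j\<in>{m..K}. e \<le> norm (S (q + (Suc k + j) * p) \<omega> - S (q + Suc k * p) \<omega>)"
            and "dist x (S (q + Suc l * p) \<omega>) < e / 2" "dist x (S (q + Suc k * p) \<omega>) < e / 2"
            unfolding E_def mem_ball by blast+
          then have far: "e \<le> norm (S (q + Suc l * p) \<omega> - S (q + Suc k * p) \<omega>)"
            and "dist (S (q + Suc l * p) \<omega>) (S (q + Suc k * p) \<omega>) < e"
            using gap by (metis, metis dist_triangle_half_r)
          with far show False by (simp add: dist_norm)
        qed
      qed (use \<open>0 < m\<close> in auto)
    qed (use ev in auto)
    finally show ?thesis .
  qed
  have "\<rho> = 0"
  proof (rule ccontr)
    assume "\<rho> \<noteq> 0"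
    have "summable (\<lambda>k. a k * \<rho>)"
      by (rule summableI_nonneg_bounded[where x = "real m"]) (simp add: a_def \<rho>_def, rule bound)
    then have "summable a" using \<open>\<rho> \<noteq> 0\<close> by (simp add: summable_cmult_iff mult.commute[of _ \<rho>])
    with a_inf show False by simp
  qed
  then show ?thesis by (simp add: \<rho>_def)
qed

lemma AE_frequently_return:
  assumes inf: "\<not> summable (\<lambda>k. prob {\<omega> \<in> space M. norm (S (q + k * p) \<omega>) < c})" and "0 < e"
  shows "AE \<omega> in M. \<exists>\<^sub>F k in sequentially. norm (S (q + k * p) \<omega> - S q \<omega>) < e"
proof -
  have "AE \<omega> in M. \<not> (\<forall>j\<ge>Suc m. e \<le> norm (S (q + j * p) \<omega> - S q \<omega>))" for m
    using prob_no_return_eq_0[OF assms, of "Suc m"] by (simp add: prob_Collect_eq_0)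
  then have "AE \<omega> in M. \<forall>m. \<not> (\<forall>j\<ge>Suc m. e \<le> norm (S (q + j * p) \<omega> - S q \<omega>))"
    by (simp add: AE_all_countable)
  then show ?thesis
  proof eventually_elim
    fix \<omega> assume "\<forall>m. \<not> (\<forall>j\<ge>Suc m. e \<le> norm (S (q + j * p) \<omega> - S q \<omega>))"
    then show "\<exists>\<^sub>F k in sequentially. norm (S (q + k * p) \<omega> - S q \<omega>) < e"
      unfolding frequently_sequentially by (meson Suc_leD not_less)
  qed
qed

section \<open>Independence of the starting time\<close>

lemma distr_start: "distr M borel (\<lambda>\<omega>. S n \<omega> - S 0 \<omega>) = distr M borel (S n)"
  by (rule distr_cong_AE) (use start in auto)

text \<open>For \<open>0 < m < k * p\<close> the time \<open>k * p\<close> splits the first increment into the increments over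
  \<open>{m..k * p}\<close> and \<open>{k * p..m + k * p}\<close>, and by periodicity the latter is distributed as the one
  over \<open>{0..m}\<close>. In the other order these two laws compose to that of \<open>S (k * p) - S 0\<close>.\<close>
lemma distr_shifted_period:
  assumes "m \<le> k * p"
  shows "distr M borel (\<lambda>\<omega>. S (m + k * p) \<omega> - S m \<omega>) = distr M borel (S (k * p))"
proof (cases "m = 0 \<or> m = k * p")
  case True
  then show ?thesis
    using distr_start[of "k * p"] distr_increment_shift[of "k * p" k 0] by auto
next
  case False
  with assms have m: "0 < m" "m < k * p" by auto
  let ?\<mu> = "\<lambda>i j. distr M borel (\<lambda>\<omega>. S j \<omega> - S i \<omega>)"
  have conv: "?\<mu> i l = (?\<mu> i j \<star> ?\<mu> j l)" if "i < j" "j < l" for i j l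
  proof -
    define t where "t n = (if n = 0 then i else if n = 1 then j else l)" for n :: nat
    have "strict_mono_on {..2} t"
      using that by (auto simp: strict_mono_on_def t_def)
    from indep_increments[OF this]
    have "indep_var (Pi\<^sub>M {0} (\<lambda>_. borel)) (\<lambda>\<omega>. \<lambda>n\<in>{0}. S (t (Suc n)) \<omega> - S (t n) \<omega>)
        (Pi\<^sub>M {1} (\<lambda>_. borel)) (\<lambda>\<omega>. \<lambda>n\<in>{1}. S (t (Suc n)) \<omega> - S (t n) \<omega>)"
      by (rule indep_var_restrict) auto
    then have "indep_var borel ((\<lambda>d. d 0) \<circ> (\<lambda>\<omega>. \<lambda>n\<in>{0}. S (t (Suc n)) \<omega> - S (t n) \<omega>))
        borel ((\<lambda>d. d 1) \<circ> (\<lambda>\<omega>. \<lambda>n\<in>{1}. S (t (Suc n)) \<omega> - S (t n) \<omega>))"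
      by (rule indep_var_compose) (auto intro!: measurable_component_singleton)
    then have "indep_var borel (\<lambda>\<omega>. S j \<omega> - S i \<omega>) borel (\<lambda>\<omega>. S l \<omega> - S j \<omega>)"
      by (simp add: comp_def t_def)
    from sum_indep_random_variable[OF this] show ?thesis by simp
  qed
  have "?\<mu> m (m + k * p) = (?\<mu> m (k * p) \<star> ?\<mu> (k * p) (m + k * p))"
    using m by (intro conv) auto
  also have "?\<mu> (k * p) (m + k * p) = ?\<mu> 0 m"
    using distr_increment_shift[of m k 0] by simp
  also have "(?\<mu> m (k * p) \<star> ?\<mu> 0 m) = (?\<mu> 0 m \<star> ?\<mu> m (k * p))"
    by (rule convolution_commutative) (auto intro!: finite_measure_distr)
  also have "\<dots> = ?\<mu> 0 (k * p)" using m by (intro conv[symmetric]) auto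
  also have "\<dots> = distr M borel (S (k * p))" by (rule distr_start)
  finally show ?thesis .
qed

lemma summable_shifted_period_iff:
  "summable (\<lambda>k. prob {\<omega> \<in> space M. norm (S (m + k * p) \<omega> - S m \<omega>) < e}) \<longleftrightarrow>
    summable (\<lambda>k. prob {\<omega> \<in> space M. norm (S (k * p) \<omega>) < e})"
proof (rule summable_cong, unfold eventually_sequentially, intro exI allI impI)
  fix k assume "m \<le> k"
  also have "k \<le> k * p" using period_pos by simp
  finally have law: "distr M borel (\<lambda>\<omega>. S (m + k * p) \<omega> - S m \<omega>) = distr M borel (S (k * p))"
    by (rule distr_shifted_period)
  have "prob {\<omega> \<in> space M. norm (X \<omega>) < e} = measure (distr M borel X) (ball 0 e)"
    if [measurable]: "random_variable borel X" for X :: "'a \<Rightarrow> real ^ 'd"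
    by (subst measure_distr) (auto intro!: arg_cong[where f = prob])
  then show "prob {\<omega> \<in> space M. norm (S (m + k * p) \<omega> - S m \<omega>) < e} =
      prob {\<omega> \<in> space M. norm (S (k * p) \<omega>) < e}"
    by (simp add: law)
qed

section \<open>Recurrence, transience and the expected number of visits\<close>

lemma m_recurrent_iff:
  "m_recurrent M m S \<longleftrightarrow>
    (\<forall>e>0. AE \<omega> in M. \<exists>\<^sub>F n in sequentially. norm (S n \<omega> - S m \<omega>) < e)"
proof -
  have "m_recurrent M m S \<longleftrightarrow>
    (\<forall>k. AE \<omega> in M. \<exists>\<^sub>F n in sequentially. norm (S n \<omega> - S m \<omega>) < inverse (real (Suc k)))"
    by (simp add: m_recurrent_def liminf_eq_0_iff_frequently_small AE_all_countable del: of_nat_Suc)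
  also have "\<dots> \<longleftrightarrow> (\<forall>e>0. AE \<omega> in M. \<exists>\<^sub>F n in sequentially. norm (S n \<omega> - S m \<omega>) < e)"
  proof (intro iffI allI impI)
    fix e :: real
    assume all: "\<forall>k. AE \<omega> in M. \<exists>\<^sub>F n in sequentially. norm (S n \<omega> - S m \<omega>) < inverse (real (Suc k))"
      and "0 < e"
    obtain k where k: "inverse (real (Suc k)) < e"
      using reals_Archimedean[OF \<open>0 < e\<close>] by auto
    from all have "AE \<omega> in M. \<exists>\<^sub>F n in sequentially. norm (S n \<omega> - S m \<omega>) < inverse (real (Suc k))"
      by blast
    then show "AE \<omega> in M. \<exists>\<^sub>F n in sequentially. norm (S n \<omega> - S m \<omega>) < e"
      by eventually_elim (use k in \<open>auto elim!: frequently_elim1\<close>)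
  qed auto
  finally show ?thesis .
qed

lemma not_summable_of_0_recurrent:
  assumes "m_recurrent M 0 S" "0 < e"
  shows "\<not> summable (\<lambda>n. prob {\<omega> \<in> space M. norm (S n \<omega>) < e})"
proof (rule not_summable_of_AE_frequently)
  have "AE \<omega> in M. \<exists>\<^sub>F n in sequentially. norm (S n \<omega> - S 0 \<omega>) < e"
    using assms by (simp add: m_recurrent_iff)
  then show "AE \<omega> in M. \<exists>\<^sub>F n in sequentially. norm (S n \<omega>) < e"
    using start by eventually_elim simp
qed measurable

text \<open>A divergent series over all times diverges along some residue class \<open>q\<close>. This forces returns to
  \<open>S q\<close> along that class, so the series of return probabilities from time \<open>q\<close> diverges,
  and this series does not depend on the starting time up to finitely many terms.
  In particular the radius may be changed from \<open>c\<close> to any \<open>e > 0\<close>.\<close>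
lemma not_summable_period:
  assumes "\<not> summable (\<lambda>n. prob {\<omega> \<in> space M. norm (S n \<omega>) < c})" "0 < e"
  shows "\<not> summable (\<lambda>k. prob {\<omega> \<in> space M. norm (S (k * p) \<omega>) < e})"
proof -
  obtain q where "\<not> summable (\<lambda>k. prob {\<omega> \<in> space M. norm (S (q + k * p) \<omega>) < c})"
    using summable_residue_classes[OF period_pos] assms(1) by meson
  from AE_frequently_return[OF this \<open>0 < e\<close>]
  have "\<not> summable (\<lambda>k. prob {\<omega> \<in> space M. norm (S (q + k * p) \<omega> - S q \<omega>) < e})"
    by (intro not_summable_of_AE_frequently) measurable
  then show ?thesis by (simp add: summable_shifted_period_iff)
qed

lemma recurrent_of_not_summable:
  assumes inf: "\<not> summable (\<lambda>n. prob {\<omega> \<in> space M. norm (S n \<omega>) < c})"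
  shows "recurrent M S"
  unfolding recurrent_def m_recurrent_iff
proof (intro allI impI)
  fix m :: nat and e :: real assume "0 < e"
  interpret shifted: semi_random_walk M "\<lambda>n \<omega>. S (m + n) \<omega> - S m \<omega>" p
    by (rule shifted_walk)
  have "\<not> summable (\<lambda>k. prob {\<omega> \<in> space M. norm (S (m + k * p) \<omega> - S m \<omega>) < e})"
    unfolding summable_shifted_period_iff by (rule not_summable_period[OF inf \<open>0 < e\<close>])
  then have "AE \<omega> in M. \<exists>\<^sub>F k in sequentially. norm (S (m + k * p) \<omega> - S m \<omega>) < e"
    using shifted.AE_frequently_return[of 0 e e] \<open>0 < e\<close> by simp
  then show "AE \<omega> in M. \<exists>\<^sub>F n in sequentially. norm (S n \<omega> - S m \<omega>) < e"
  proof eventually_elim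
    fix \<omega> assume freq: "\<exists>\<^sub>F k in sequentially. norm (S (m + k * p) \<omega> - S m \<omega>) < e"
    show "\<exists>\<^sub>F n in sequentially. norm (S n \<omega> - S m \<omega>) < e"
      unfolding frequently_sequentially
    proof
      fix N
      obtain k where "N \<le> k" "norm (S (m + k * p) \<omega> - S m \<omega>) < e"
        using freq unfolding frequently_sequentially by blast
      moreover have "k \<le> m + k * p" using period_pos by (simp add: trans_le_add2)
      ultimately show "\<exists>n\<ge>N. norm (S n \<omega> - S m \<omega>) < e" by (meson order_trans)
    qed
  qed
qed

lemma transient_of_summable:
  assumes "\<And>c. 0 < c \<Longrightarrow> summable (\<lambda>n. prob {\<omega> \<in> space M. norm (S n \<omega>) < c})"
  shows "transient M S"
proof -
  have "AE \<omega> in M. \<forall>\<^sub>F n in sequentially. \<not> norm (S n \<omega>) < real (Suc k)" for k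
    using assms[of "real (Suc k)"] by (intro AE_eventually_not_of_summable) auto
  then have "AE \<omega> in M. \<forall>k. \<forall>\<^sub>F n in sequentially. \<not> norm (S n \<omega>) < real (Suc k)"
    by (simp add: AE_all_countable)
  then show ?thesis
    unfolding transient_def
  proof eventually_elim
    fix \<omega> assume big: "\<forall>k. \<forall>\<^sub>F n in sequentially. \<not> norm (S n \<omega>) < real (Suc k)"
    show "filterlim (\<lambda>n. norm (S n \<omega>)) at_top sequentially"
      unfolding filterlim_at_top
    proof
      fix Z :: real
      obtain k where "Z \<le> real k" using real_arch_simple by blast
      with big[rule_format, of k] show "\<forall>\<^sub>F n in sequentially. Z \<le> norm (S n \<omega>)"
        by (auto elim!: eventually_mono)
    qed
  qed
qed

lemma not_transient_of_0_recurrent: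
  assumes "m_recurrent M 0 S"
  shows "\<not> transient M S"
proof
  assume "transient M S"
  then have "AE \<omega> in M. filterlim (\<lambda>n. norm (S n \<omega>)) at_top sequentially"
    by (simp add: transient_def)
  moreover have "AE \<omega> in M. \<exists>\<^sub>F n in sequentially. norm (S n \<omega> - S 0 \<omega>) < 1"
    using assms by (simp add: m_recurrent_iff)
  ultimately have "AE \<omega> in M. False"
    using start
  proof eventually_elim
    fix \<omega> assume lim: "filterlim (\<lambda>n. norm (S n \<omega>)) at_top sequentially"
      and freq: "\<exists>\<^sub>F n in sequentially. norm (S n \<omega> - S 0 \<omega>) < 1" and "S 0 \<omega> = 0"
    from lim have "\<forall>\<^sub>F n in sequentially. 1 \<le> norm (S n \<omega>)" by (simp add: filterlim_at_top)
    with freq \<open>S 0 \<omega> = 0\<close> show False by (simp add: frequently_def not_less)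
  qed
  then show False by simp
qed

text \<open>Omitting the visit at time \<open>0\<close> does not affect convergence.\<close>
lemma suminf_visits_finite_iff:
  "(\<Sum>n. emeasure M {\<omega> \<in> space M. S (Suc n) \<omega> \<in> ball 0 a}) < \<infinity> \<longleftrightarrow>
    summable (\<lambda>n. prob {\<omega> \<in> space M. norm (S n \<omega>) < a})"
proof -
  define f where "f n = prob {\<omega> \<in> space M. norm (S n \<omega>) < a}" for n
  have nonneg: "0 \<le> f (Suc n)" for n by (simp add: f_def)
  have "emeasure M {\<omega> \<in> space M. S (Suc n) \<omega> \<in> ball 0 a} = ennreal (f (Suc n))" for n
    by (simp add: f_def emeasure_eq_measure)
  then have "(\<Sum>n. emeasure M {\<omega> \<in> space M. S (Suc n) \<omega> \<in> ball 0 a}) < \<infinity> \<longleftrightarrow>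
      (\<Sum>n. ennreal (f (Suc n))) \<noteq> top"
    by (simp only: top.not_eq_extremum infinity_ennreal_def)
  also have "\<dots> \<longleftrightarrow> summable (\<lambda>n. f (Suc n))"
    using summable_suminf_not_top[of "\<lambda>n. f (Suc n)", OF nonneg]
      ennreal_suminf_neq_top[of "\<lambda>n. f (Suc n)", OF _ nonneg] by blast
  also have "\<dots> \<longleftrightarrow> summable f" by (rule summable_Suc_iff)
  finally show ?thesis unfolding f_def .
qed

end

theorem theorem2p5:
  fixes M :: "'a measure" and S :: "nat \<Rightarrow> 'a \<Rightarrow> real ^ 'd" and p :: nat
  assumes "semi_random_walk M S p"
  shows "(m_recurrent M 0 S \<longrightarrow> recurrent M S)
    \<and> ((recurrent M S \<or> transient M S) \<and> \<not> (recurrent M S \<and> transient M S))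
    \<and> (recurrent M S \<longleftrightarrow>
        (\<forall>a>0. (\<Sum>n. emeasure M {\<omega> \<in> space M. S (Suc n) \<omega> \<in> ball 0 a}) = \<infinity>))
    \<and> (transient M S \<longleftrightarrow>
        (\<forall>a>0. (\<Sum>n. emeasure M {\<omega> \<in> space M. S (Suc n) \<omega> \<in> ball 0 a}) < \<infinity>))
    \<and> (recurrent M S \<longleftrightarrow> recurrent M (\<lambda>n. S (n * p)))"
proof -
  interpret semi_random_walk M S p by (rule assms)
  interpret multiples: semi_random_walk M "\<lambda>n. S (n * p)" 1 by (rule random_walk_multiples)
  let ?finite = "\<lambda>a. summable (\<lambda>n. prob {\<omega> \<in> space M. norm (S n \<omega>) < a})"
  have to_0: "m_recurrent M 0 S" if "recurrent M S"
    using that by (simp add: recurrent_def)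
  \<comment> \<open>Divergence for a single radius suffices for recurrence, so the radius \<open>1\<close> will do here and below.\<close>
  have from_0: "recurrent M S" if "m_recurrent M 0 S"
    by (rule recurrent_of_not_summable[OF not_summable_of_0_recurrent[OF that zero_less_one]])
  have rec: "recurrent M S \<longleftrightarrow> (\<forall>a>0. \<not> ?finite a)"
  proof
    assume "recurrent M S"
    then show "\<forall>a>0. \<not> ?finite a" by (intro allI impI not_summable_of_0_recurrent to_0)
  next
    assume "\<forall>a>0. \<not> ?finite a"
    then have "\<not> ?finite 1" by simp
    then show "recurrent M S" by (rule recurrent_of_not_summable)
  qed
  have excl: "\<not> transient M S" if "recurrent M S"
    by (rule not_transient_of_0_recurrent[OF to_0[OF that]])
  have trans: "transient M S \<longleftrightarrow> (\<forall>a>0. ?finite a)"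
  proof (intro iffI allI impI)
    fix a assume "transient M S"
    with excl have "\<not> recurrent M S" by auto
    with recurrent_of_not_summable[of a] show "?finite a" by argo
  next
    assume "\<forall>a>0. ?finite a"
    then show "transient M S" by (intro transient_of_summable) simp
  qed
  have alt: "recurrent M S \<or> transient M S"
  proof (cases "\<forall>a>0. ?finite a")
    case True
    then show ?thesis using trans by simp
  next
    case False
    then obtain a where "\<not> ?finite a" by auto
    then show ?thesis using recurrent_of_not_summable[of a] by simp
  qed
  have mult: "recurrent M S \<longleftrightarrow> recurrent M (\<lambda>n. S (n * p))"
  proof
    assume "recurrent M S"
    then have "\<not> ?finite 1" using rec by simp
    from not_summable_period[OF this, of 1] show "recurrent M (\<lambda>n. S (n * p))"
      by (intro multiples.recurrent_of_not_summable) simp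
  next
    assume "recurrent M (\<lambda>n. S (n * p))"
    then have "m_recurrent M 0 (\<lambda>n. S (n * p))" by (simp add: recurrent_def)
    from multiples.not_summable_of_0_recurrent[OF this, of 1]
    have inf: "\<not> summable (\<lambda>k. prob {\<omega> \<in> space M. norm (S (k * p) \<omega>) < 1})" by simp
    have "inj (\<lambda>k. k * p)" using period_pos by (auto simp: inj_on_def)
    with inf have "\<not> ?finite 1"
      using summable_reindex[of "\<lambda>n. prob {\<omega> \<in> space M. norm (S n \<omega>) < 1}" "\<lambda>k. k * p"]
      by (auto simp: comp_def)
    then show "recurrent M S" by (rule recurrent_of_not_summable)
  qed
  have top: "(\<Sum>n. emeasure M {\<omega> \<in> space M. S (Suc n) \<omega> \<in> ball 0 a}) = \<infinity> \<longleftrightarrow> \<not> ?finite a" for a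
    unfolding suminf_visits_finite_iff[symmetric] infinity_ennreal_def
    by (simp only: top.not_eq_extremum[symmetric] not_not)
  show ?thesis
    unfolding top suminf_visits_finite_iff
    using excl by (intro conjI impI from_0 alt rec trans mult) simp_all
qed

end
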